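(* Let $N\ge0$ be a fixed integer. As $\Omega\to0$ (with $\Omega\in\mathbb{R}$), $$\rho_N^+=-i\,D_N\,\Omega^{2N+3}+\mathcal{O}(\Omega^{2N+5}),$$ where $D_0=\frac1{24}$ and, for $N\ge1$, $$D_N=\frac{1}{2(2N+1)(2N+3)}\left[\frac{N!}{(2N+1)!}\right]^2 .$$
   Context: ${}_1F_1(a,b,z)=\sum_{m\ge0}\frac{(a)_m}{(b)_m}\frac{z^m}{m!}$ with $(a)_0=1$, $(a)_m=a(a+1)\cdots(a+m-1)$; when $a$ is a non-positive integer the series is understood to terminate at $m=-a$. For $\Omega\in\mathbb{R}$ set $$F_N^\pm={}_1F_1(-N,-2N-1,\pm i\Omega),\qquad F_{N+1}^\pm={}_1F_1(-N-1,-2N-1,\pm i\Omega)$$ (note that $F_{N+1}^\pm$ also has second parameter $-2N-1$), and $$\Xi_N=\frac{(F_N^-)^2+(F_N^+)^2+(F_{N+1}^-)^2+(F_{N+1}^+)^2}{F_N^-F_{N+1}^++F_N^+F_{N+1}^-},$$ which is real, and well defined for small $|\Omega|$. The discrete Floquet multipliers $\lambda_N^\pm$ (for the energy-conserving DG method with $\alpha=1$) are the two roots of $\lambda^2-\Xi_N\lambda+1=0$, labelled by $$\lambda_N^\pm=\frac{\Xi_N\pm\sqrt{\Xi_N^2-4}}{2}\ \text{ if }\sin(\Omega)\ge0,\qquad \lambda_N^\pm=\frac{\Xi_N\mp\sqrt{\Xi_N^2-4}}{2}\ \text{ if }\sin(\Omega)<0,$$ where $\sqrt{x}=i\sqrt{|x|}$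 for real $x<0$. The relative error is $$\rho_N^+=\frac{\mathrm{e}^{i\Omega}-\lambda_N^+}{\mathrm{e}^{i\Omega}}.$$ *)

theory Defs
  imports Complex_Main "HOL-Library.Landau_Symbols"
begin

text \<open>
  Since \<open>x / 0 = 0\<close>, for \<open>a = -n\<close> all terms with \<open>m > n\<close> vanish, also when
  \<open>pochhammer b m = 0\<close>; so the series terminates at \<open>m = n\<close>, see \<open>hyp1F1_terminates\<close>.
\<close>
definition hyp1F1 :: "complex \<Rightarrow> complex \<Rightarrow> complex \<Rightarrow> complex" where
  "hyp1F1 a b z = (\<Sum>m. pochhammer a m / pochhammer b m * (z ^ m / fact m))"

lemma hyp1F1_terminates:
  "hyp1F1 (- of_nat n) b z =
     (\<Sum>m\<le>n. pochhammer (- of_nat n) m / pochhammer b m * (z ^ m / fact m))"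
  unfolding hyp1F1_def
  by (rule suminf_finite) (auto simp: pochhammer_of_nat_eq_0_iff)

text \<open>\<open>F_N\<close> at \<open>z = \<plusminus>i\<Omega>\<close> is \<open>F\<^sub>N\<^sup>\<plusminus>\<close>, and \<open>F_N1\<close> at \<open>z = \<plusminus>i\<Omega>\<close> is \<open>F\<^sub>N\<^sub>+\<^sub>1\<^sup>\<plusminus>\<close>.\<close>
definition F_N :: "nat \<Rightarrow> complex \<Rightarrow> complex" where
  "F_N N z = hyp1F1 (- of_nat N) (- 2 * of_nat N - 1) z"

definition F_N1 :: "nat \<Rightarrow> complex \<Rightarrow> complex" where
  "F_N1 N z = hyp1F1 (- of_nat N - 1) (- 2 * of_nat N - 1) z"

definition Xi :: "nat \<Rightarrow> real \<Rightarrow> complex" where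
  "Xi N \<Omega> = (let z = \<i> * of_real \<Omega> in
     ((F_N N (-z))\<^sup>2 + (F_N N z)\<^sup>2 + (F_N1 N (-z))\<^sup>2 + (F_N1 N z)\<^sup>2)
       / (F_N N (-z) * F_N1 N z + F_N N z * F_N1 N (-z)))"

lemma cnj_hyp1F1_terminating:
  assumes "cnj b = b"
  shows "cnj (hyp1F1 (- of_nat n) b z) = hyp1F1 (- of_nat n) b (cnj z)"
proof -
  have p: "cnj (pochhammer c m) = pochhammer c m" if "cnj c = c" for c m
    using that by (induction m) (simp_all add: pochhammer_Suc)
  show ?thesis
    using assms by (simp add: hyp1F1_terminates p)
qed

lemma Xi_real: "Xi N \<Omega> \<in> \<real>"
proof -
  have F: "cnj (F_N N z) = F_N N (cnj z)" for z
    unfolding F_N_def by (rule cnj_hyp1F1_terminating) simp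
  have eq: "- of_nat N - 1 = - (of_nat (Suc N) :: complex)"
    by simp
  have F1: "cnj (F_N1 N z) = F_N1 N (cnj z)" for z
    unfolding F_N1_def eq by (rule cnj_hyp1F1_terminating) simp
  have "cnj (Xi N \<Omega>) = Xi N \<Omega>"
    by (simp add: Xi_def Let_def F F1 add_ac mult_ac)
  thus ?thesis
    by (simp add: Reals_cnj_iff)
qed

text \<open>
  \<open>Xi\<close> is real (\<open>Xi_real\<close>), and on the negative reals \<open>csqrt x = \<i> * sqrt \<bar>x\<bar>\<close>.
\<close>
definition lambda_plus :: "nat \<Rightarrow> real \<Rightarrow> complex" where
  "lambda_plus N \<Omega> =
     (if sin \<Omega> \<ge> 0 then (Xi N \<Omega> + csqrt ((Xi N \<Omega>)\<^sup>2 - 4)) / 2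
      else (Xi N \<Omega> - csqrt ((Xi N \<Omega>)\<^sup>2 - 4)) / 2)"

definition lambda_minus :: "nat \<Rightarrow> real \<Rightarrow> complex" where
  "lambda_minus N \<Omega> =
     (if sin \<Omega> \<ge> 0 then (Xi N \<Omega> - csqrt ((Xi N \<Omega>)\<^sup>2 - 4)) / 2
      else (Xi N \<Omega> + csqrt ((Xi N \<Omega>)\<^sup>2 - 4)) / 2)"

lemma lambda_roots:
  "x\<^sup>2 - Xi N \<Omega> * x + 1 = (x - lambda_plus N \<Omega>) * (x - lambda_minus N \<Omega>)"
proof -
  define s where "s = csqrt ((Xi N \<Omega>)\<^sup>2 - 4)"
  have s: "s * s = Xi N \<Omega> * Xi N \<Omega> - 4"
    unfolding s_def power2_eq_square [symmetric] by simp
  have "(x - (Xi N \<Omega> + s) / 2) * (x - (Xi N \<Omega> - s) / 2)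
        = x\<^sup>2 - Xi N \<Omega> * x + (Xi N \<Omega> * Xi N \<Omega> - s * s) / 4"
    by (simp add: field_simps power2_eq_square)
  also have "\<dots> = x\<^sup>2 - Xi N \<Omega> * x + 1"
    by (simp add: s)
  finally show ?thesis
    by (simp add: lambda_plus_def lambda_minus_def s_def [symmetric] mult.commute)
qed

definition rho_plus :: "nat \<Rightarrow> real \<Rightarrow> complex" where
  "rho_plus N \<Omega> =
     (exp (\<i> * of_real \<Omega>) - lambda_plus N \<Omega>) / exp (\<i> * of_real \<Omega>)"

definition D :: "nat \<Rightarrow> real" where
  "D N = (if N = 0 then 1 / 24
          else 1 / (2 * (2 * real N + 1) * (2 * real N + 3))
                 * (fact N / fact (2 * N + 1))\<^sup>2)"

end

theory Submission
  imports Defs "HOL-Analysis.FPS_Convergence"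
begin

text \<open>
  \<open>F_N1 z / F_N (-z)\<close> is the \<open>[N+1/N]\<close> Pade approximant of \<open>exp z\<close>: the residual
  \<open>r z = exp z * F_N (-z) - F_N1 z\<close> is \<open>O(z^(2N+2))\<close>, and its coefficients are alternating
  binomial sums. With \<open>z = i\<Omega>\<close>, the numerator of \<open>Xi\<close> minus \<open>2 cos \<Omega>\<close> times its denominator
  equals \<open>r(z)^2 + r(-z)^2 - 2 sinh z * (r(z) F_N(-z) - r(-z) F_N(z))\<close>. The odd part in the last
  bracket makes this \<open>O(z^(2N+4))\<close>; the squares are \<open>O(z^(4N+4))\<close> and so contribute to the leading
  term exactly when \<open>N = 0\<close>, which is why \<open>D 0\<close> is exceptional. This gives
  \<open>\<epsilon> = Xi - 2 cos \<Omega> = -2 D_N \<Omega>^(2N+4) + O(\<Omega>^(2N+6))\<close>.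

  With \<open>u = exp(i\<Omega>)\<close> one has \<open>(u - \<lambda>\<^sub>+)(u - \<lambda>\<^sub>-) = -u\<epsilon>\<close>, that is,
  \<open>\<rho> (2i sin \<Omega> - u\<rho> - \<epsilon>) = -\<epsilon>\<close>. The choice of the square root forces \<open>Im \<lambda>\<^sub>-\<close> and \<open>sin \<Omega>\<close>
  to have opposite signs, so \<open>|u - \<lambda>\<^sub>-| \<ge> |sin \<Omega>|\<close> and \<open>\<rho> = O(\<Omega>^(2N+3))\<close>, which turns the
  quadratic equation into \<open>\<rho> = i\<epsilon> / (2\<Omega>) + O(\<Omega>^(2N+5))\<close>.
\<close>

unbundle no vec_syntax and fps_syntax

section \<open>Alternating binomial sums\<close>

text \<open>Pascal's rule. Up to sign these sums are iterated finite differences at 0, so one unit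
  of \<open>n\<close> can be traded for one difference of \<open>f\<close>.\<close>

lemma alternating_binomial_sum_Suc:
  fixes f :: "nat \<Rightarrow> 'a::comm_ring_1"
  shows "(\<Sum>j\<le>Suc n. (-1) ^ j * of_nat (Suc n choose j) * f j) =
           (\<Sum>j\<le>n. (-1) ^ j * of_nat (n choose j) * (f j - f (Suc j)))"
proof -
  have "(\<Sum>j\<le>Suc n. (-1) ^ j * of_nat (Suc n choose j) * f j) =
          f 0 + (\<Sum>j\<le>n. (-1) ^ Suc j * of_nat (Suc n choose Suc j) * f (Suc j))"
    by (subst sum.atMost_Suc_shift) simp
  also have "(\<Sum>j\<le>n. (-1) ^ Suc j * of_nat (Suc n choose Suc j) * f (Suc j)) =
      (\<Sum>j\<le>n. (-1) ^ Suc j * of_nat (n choose Suc j) * f (Suc j)) -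
      (\<Sum>j\<le>n. (-1) ^ j * of_nat (n choose j) * f (Suc j))"
    unfolding sum_subtractf[symmetric] by (intro sum.cong refl) (simp add: algebra_simps)
  also have "f 0 + (\<dots>) = (f 0 + (\<Sum>j\<le>n. (-1) ^ Suc j * of_nat (n choose Suc j) * f (Suc j))) -
      (\<Sum>j\<le>n. (-1) ^ j * of_nat (n choose j) * f (Suc j))"
    by simp
  also have "f 0 + (\<Sum>j\<le>n. (-1) ^ Suc j * of_nat (n choose Suc j) * f (Suc j)) =
      (\<Sum>j\<le>Suc n. (-1) ^ j * of_nat (n choose j) * f j)"
    by (subst sum.atMost_Suc_shift) simp
  also have "\<dots> = (\<Sum>j\<le>n. (-1) ^ j * of_nat (n choose j) * f j)"
    by (simp add: binomial_eq_0)
  finally show ?thesis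
    by (simp add: algebra_simps flip: sum_subtractf)
qed

text \<open>Differencing \<open>M - j choose (M - k)\<close> in \<open>j\<close> is again Pascal's
  rule: it lowers \<open>M\<close> by one and keeps \<open>k\<close>, which drives the induction on
  \<open>n\<close>.\<close>

lemma alternating_sum_choose_choose:
  assumes "n \<le> M" "k \<le> M"
  shows "(\<Sum>j\<le>n. (-1) ^ j * of_nat (n choose j) * of_nat (M - j choose (M - k))) =
           (of_nat (M - n choose k) :: 'a::comm_ring_1)"
  using assms
proof (induction n arbitrary: M)
  case 0
  then show ?case by (simp add: binomial_symmetric[of k M])
next
  case (Suc n)
  then obtain m where M: "M = Suc m" by (cases M) auto
  show ?case
  \<comment> \<open>For \<open>k = M\<close> the lower index is 0, where Pascal's rule fails; both
    sides vanish.\<close>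
  proof (cases "k = M")
    case True
    then show ?thesis
      using Suc.prems by (simp only: alternating_binomial_sum_Suc) (simp add: binomial_eq_0)
  next
    case False
    have "of_nat (M - j choose (M - k)) - of_nat (M - Suc j choose (M - k)) =
            (of_nat (m - j choose (m - k)) :: 'a)" if "j \<le> n" for j
    proof -
      have "M - j = Suc (m - j)" "M - k = Suc (m - k)" "M - Suc j = m - j"
        using that Suc.prems M False by auto
      then show ?thesis by simp
    qed
    then have "(\<Sum>j\<le>n. (-1) ^ j * of_nat (n choose j) *
          (of_nat (M - j choose (M - k)) - of_nat (M - Suc j choose (M - k)))) =
        (\<Sum>j\<le>n. (-1) ^ j * of_nat (n choose j) * (of_nat (m - j choose (m - k)) :: 'a))"
      by (intro sum.cong) auto
    then show ?thesis
      using Suc M False by (simp only: alternating_binomial_sum_Suc) simp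
  qed
qed

text \<open>The right-hand side is \<open>(-1)^n * n! / (x (x-1) ... (x-n))\<close>; the sum is its
  partial fraction decomposition, or equivalently an iterated difference of
  \<open>1/x\<close>.\<close>

lemma alternating_sum_choose_reciprocal:
  assumes "n < x"
  shows "(\<Sum>j\<le>n. (-1) ^ j * of_nat (n choose j) * (1 / of_nat (x - j))) =
           (-1) ^ n * fact n * fact (x - Suc n) / (fact x :: 'a::field_char_0)"
  using assms
proof (induction n arbitrary: x)
  case 0
  then obtain y where x: "x = Suc y" by (cases x) auto
  have "(fact x :: 'a) = of_nat x * fact y" "(of_nat x :: 'a) \<noteq> 0"
    unfolding x by (simp_all only: fact_Suc of_nat_eq_0_iff)
  then show ?case by (simp add: x del: fact_Suc of_nat_Suc)
next
  case (Suc n)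
  obtain y where x: "x = Suc (Suc (n + y))"
    using Suc.prems less_iff_Suc_add by auto
  have "(\<Sum>j\<le>Suc n. (-1) ^ j * of_nat (Suc n choose j) * (1 / of_nat (x - j) :: 'a)) =
     (\<Sum>j\<le>n. (-1) ^ j * of_nat (n choose j) * (1 / of_nat (x - j))) -
     (\<Sum>j\<le>n. (-1) ^ j * of_nat (n choose j) * (1 / of_nat (x - 1 - j)))"
    by (simp only: alternating_binomial_sum_Suc) (simp add: algebra_simps sum_subtractf)
  also have "\<dots> = (-1) ^ n * fact n * fact (Suc y) / fact x -
       (-1) ^ n * fact n * fact y / fact (Suc (n + y))"
    using Suc.IH[of x] Suc.IH[of "x - 1"] by (simp add: x)
  also have "\<dots> = (-1) ^ n * fact n * fact y / fact (Suc (n + y)) *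
       ((of_nat (Suc y) - of_nat x) / of_nat x)"
  proof -
    have "(fact x :: 'a) = of_nat x * fact (Suc (n + y))" "(fact (Suc y) :: 'a) = of_nat (Suc y) * fact y"
      unfolding x by (simp_all only: fact_Suc)
    moreover have "(of_nat x :: 'a) \<noteq> 0" by (simp only: of_nat_eq_0_iff) (simp add: x)
    ultimately show ?thesis
      by (simp add: diff_divide_distrib right_diff_distrib mult_ac)
  qed
  also have "of_nat (Suc y) - of_nat x = - (of_nat (Suc n) :: 'a)"
    by (simp add: x)
  also have "(-1) ^ n * fact n * fact y / fact (Suc (n + y)) * (- of_nat (Suc n) / of_nat x) =
       (-1) ^ Suc n * fact (Suc n) * fact y / (fact x :: 'a)"
    unfolding x by (simp only: fact_Suc[of n] fact_Suc[of "Suc (n + y)"])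
      (simp add: mult_ac del: fact_Suc of_nat_Suc)
  finally show ?case by (simp add: x)
qed

section \<open>Taylor coefficients of the Pade polynomials and of the residual\<close>

text \<open>The series in \<open>z\<close> of \<open>hyp1F1 (-n) (-M) (s * z)\<close> for
  \<open>n \<le> M\<close>; the signs of the two Pochhammer symbols cancel. Taking
  \<open>s = -1\<close> encodes evaluation at \<open>-z\<close>.\<close>

definition pade_fps :: "nat \<Rightarrow> nat \<Rightarrow> complex \<Rightarrow> complex fps" where
  "pade_fps n M s = Abs_fps (\<lambda>k. of_nat (n choose k) * fact (M - k) / fact M * s ^ k)"

lemma pade_fps_nth: "pade_fps n M s $ k = of_nat (n choose k) * fact (M - k) / fact M * s ^ k"
  by (simp add: pade_fps_def)

lemma pochhammer_neg_of_nat: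
  assumes "k \<le> n"
  shows "pochhammer (- of_nat n) k = ((-1) ^ k * fact n / fact (n - k) :: 'a::field_char_0)"
  using assms
proof (induction k)
  case (Suc k)
  then have "n - k = Suc (n - Suc k)" by simp
  then have "(fact (n - k) :: 'a) = of_nat (n - k) * fact (n - Suc k)"
    by (metis fact_Suc)
  moreover have "(of_nat (n - k) :: 'a) \<noteq> 0" using Suc.prems by simp
  moreover have "- of_nat n + of_nat k = - (of_nat (n - k) :: 'a)"
    using Suc.prems by (simp add: of_nat_diff)
  ultimately show ?case
    using Suc by (simp add: pochhammer_Suc del: of_nat_diff)
qed simp

lemma hyp1F1_has_fps_expansion:
  assumes "n \<le> M"
  shows "(\<lambda>z. hyp1F1 (- of_nat n) (- of_nat M) (s * z)) has_fps_expansion pade_fps n M s"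
proof -
  have "pochhammer (- of_nat n) k / pochhammer (- of_nat M) k * ((s * z) ^ k / fact k) =
      of_nat (n choose k) * fact (M - k) / fact M * s ^ k * z ^ k" if "k \<le> n" for k and z :: complex
    using that assms
    by (simp add: pochhammer_neg_of_nat binomial_fact power_mult_distrib divide_simps)
  then have "(\<lambda>z. hyp1F1 (- of_nat n) (- of_nat M) (s * z)) =
      (\<lambda>z. \<Sum>k\<le>n. of_nat (n choose k) * fact (M - k) / fact M * s ^ k * z ^ k)"
    unfolding hyp1F1_terminates by (intro ext sum.cong) auto
  moreover have "pade_fps n M s =
      (\<Sum>k\<le>n. fps_const (of_nat (n choose k) * fact (M - k) / fact M * s ^ k) * fps_X ^ k)"
  proof (rule fps_ext)
    fix i
    show "pade_fps n M s $ i =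
        (\<Sum>k\<le>n. fps_const (of_nat (n choose k) * fact (M - k) / fact M * s ^ k) * fps_X ^ k) $ i"
      by (cases "i \<le> n") (simp_all add: fps_sum_nth pade_fps_nth if_distrib sum.delta cong: if_cong)
  qed
  ultimately show ?thesis
    by (simp only:) (intro fps_expansion_intros)
qed

definition pade_residual :: "nat \<Rightarrow> complex \<Rightarrow> complex fps" where
  "pade_residual N s =
     fps_exp s * pade_fps N (2 * N + 1) (- s) - pade_fps (Suc N) (2 * N + 1) s"

lemma exp_mult_pade_fps_nth:
  "(fps_exp s * pade_fps n M (- s)) $ k =
     s ^ k / fact M * (\<Sum>j\<le>k. (-1) ^ j * of_nat (n choose j) * (fact (M - j) / fact (k - j)))"
proof -
  have "(fps_exp s * pade_fps n M (- s)) $ k = (pade_fps n M (- s) * fps_exp s) $ k"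
    by (simp only: mult.commute)
  also have "\<dots> = (\<Sum>j\<le>k. pade_fps n M (- s) $ j * fps_exp s $ (k - j))"
    by (simp add: fps_mult_nth atLeast0AtMost)
  also have "\<dots> = (\<Sum>j\<le>k. s ^ k / fact M *
      ((-1) ^ j * of_nat (n choose j) * (fact (M - j) / fact (k - j))))"
  proof (intro sum.cong refl)
    fix j assume "j \<in> {..k}"
    then have "(- s) ^ j * s ^ (k - j) = (-1) ^ j * s ^ k"
      by (simp add: power_minus[of s] power_add[symmetric])
    then show "pade_fps n M (- s) $ j * fps_exp s $ (k - j) =
       s ^ k / fact M * ((-1) ^ j * of_nat (n choose j) * (fact (M - j) / fact (k - j)))"
      by (simp add: pade_fps_nth field_simps)
  qed
  finally show ?thesis by (simp add: sum_distrib_left)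
qed

text \<open>With \<open>M = 2N+1\<close> and \<open>j \<le> k \<le> M\<close>,
  \<open>fact (M-j) / fact (k-j)\<close> equals \<open>fact (M-k) * (M-j choose (M-k))\<close>, so
  the alternating sum is \<open>fact (M-k) * (N+1 choose k)\<close>. This matches the coefficient of
  \<open>F_N1\<close>.\<close>

lemma pade_residual_nth_eq_0:
  assumes "k < 2 * N + 2"
  shows "pade_residual N s $ k = 0"
proof -
  define M where "M = 2 * N + 1"
  have k: "k \<le> M" using assms by (simp add: M_def)
  let ?f = "\<lambda>j. (-1) ^ j * of_nat (N choose j) * (of_nat (M - j choose (M - k)) :: complex)"
  have "(\<Sum>j\<le>k. (-1) ^ j * of_nat (N choose j) * (fact (M - j) / fact (k - j))) =
      (\<Sum>j\<le>k. fact (M - k) * ?f j)"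
    using k by (intro sum.cong refl) (simp add: binomial_fact)
  also have "\<dots> = fact (M - k) * (\<Sum>j\<le>k. ?f j)"
    by (simp add: sum_distrib_left)
  \<comment> \<open>The added terms have \<open>M - j < M - k\<close>, so their second binomial is
    0; those with \<open>j > N\<close> then drop out through the first.\<close>
  also have "(\<Sum>j\<le>k. ?f j) = (\<Sum>j\<le>M. ?f j)"
    using k by (intro sum.mono_neutral_left) auto
  also have "\<dots> = (\<Sum>j\<le>N. ?f j)"
    by (intro sum.mono_neutral_right) (auto simp: M_def)
  also have "\<dots> = of_nat (M - N choose k)"
    using k by (intro alternating_sum_choose_choose) (auto simp: M_def)
  finally show ?thesis
    by (simp add: pade_residual_def exp_mult_pade_fps_nth pade_fps_nth M_def)
qed

text \<open>\<open>F_N1\<close> has degree \<open>N+1\<close> and no longer contributes. The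
  factorial quotient collapses to \<open>1 / (2N+2-j)\<close>, which gives a reciprocal sum.\<close>

lemma pade_residual_nth_0:
  "pade_residual N s $ (2 * N + 2) =
     s ^ (2 * N + 2) * ((-1) ^ N * (fact N / fact (2 * N + 1))\<^sup>2 / 2)"
proof -
  let ?M = "2 * N + 1"
  have f: "fact (?M - j) / fact (2 * N + 2 - j) = (1 / of_nat (2 * N + 2 - j) :: complex)"
    if "j \<le> N" for j
  proof -
    have "2 * N + 2 - j = Suc (?M - j)" using that by simp
    then show ?thesis by (simp only: fact_Suc) simp
  qed
  have "(\<Sum>j\<le>2*N+2. (-1) ^ j * of_nat (N choose j) * (fact (?M - j) / fact (2 * N + 2 - j))) =
     (\<Sum>j\<le>N. (-1) ^ j * of_nat (N choose j) * (fact (?M - j) / fact (2 * N + 2 - j) :: complex))"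
    (is "?S = _")
    by (intro sum.mono_neutral_right) auto
  also have "\<dots> = (\<Sum>j\<le>N. (-1) ^ j * of_nat (N choose j) * (1 / of_nat (2 * N + 2 - j)))"
    using f by (intro sum.cong refl) simp
  also have "\<dots> = (-1) ^ N * fact N * fact (2 * N + 2 - Suc N) / fact (2 * N + 2)"
    by (rule alternating_sum_choose_reciprocal) simp
  also have "2 * N + 2 - Suc N = Suc N" by simp
  also have "(-1) ^ N * fact N * fact (Suc N) / (fact (2 * N + 2) :: complex) =
      (-1) ^ N * (fact N)\<^sup>2 / (2 * fact ?M)"
  proof -
    have "(fact (2 * N + 2) :: complex) = of_nat (2 * Suc N) * fact ?M"
      by (metis Suc_eq_plus1 add_2_eq_Suc' fact_Suc mult_Suc_right add_Suc_right one_add_one add.commute)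
    also have "\<dots> = 2 * of_nat (Suc N) * fact ?M" by (simp only: of_nat_mult of_nat_numeral)
    finally show ?thesis
      by (simp only: fact_Suc[of N] of_nat_mult)
        (simp add: power2_eq_square divide_simps del: of_nat_Suc fact_Suc)
  qed
  finally have *: "?S = \<dots>" .
  show ?thesis
    unfolding pade_residual_def fps_sub_nth exp_mult_pade_fps_nth *
    by (simp add: pade_fps_nth power2_eq_square binomial_eq_0 del: fact_Suc of_nat_Suc)
qed

text \<open>Here the factorial quotient is \<open>1 / ((2N+3-j)(2N+2-j))\<close>, a difference of
  reciprocals. Reading \<open>alternating_binomial_sum_Suc\<close> backwards turns the sum into a
  reciprocal sum of order \<open>N+1\<close>.\<close>

lemma pade_residual_nth_1:
  "pade_residual N s $ (2 * N + 3) =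
     s ^ (2 * N + 3) * ((-1) ^ N * (fact N / fact (2 * N + 1))\<^sup>2 / 2 *
       (of_nat (N + 1) / of_nat (2 * N + 3)))"
proof -
  let ?M = "2 * N + 1"
  have f: "fact (?M - j) / fact (2 * N + 3 - j) =
      (- (1 / of_nat (2 * N + 3 - j) - 1 / of_nat (2 * N + 3 - Suc j)) :: complex)"
    if "j \<le> N" for j
  proof -
    define d where "d = ?M - j"
    have d: "2 * N + 3 - j = Suc (Suc d)" "2 * N + 3 - Suc j = Suc d"
      using that by (auto simp: d_def)
    have "(1 + of_nat d :: complex) \<noteq> 0" "(2 + of_nat d :: complex) \<noteq> 0"
      by (metis of_nat_Suc of_nat_eq_0_iff Suc_not_Zero,
          metis of_nat_Suc of_nat_eq_0_iff Suc_not_Zero add_2_eq_Suc of_nat_add of_nat_numeral)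
    then show ?thesis
      unfolding d d_def[symmetric] by (simp add: divide_simps) 
  qed
  have "(\<Sum>j\<le>2*N+3. (-1) ^ j * of_nat (N choose j) * (fact (?M - j) / fact (2 * N + 3 - j))) =
     (\<Sum>j\<le>N. (-1) ^ j * of_nat (N choose j) * (fact (?M - j) / fact (2 * N + 3 - j) :: complex))"
    (is "?S = _")
    by (intro sum.mono_neutral_right) auto
  also have "\<dots> = (\<Sum>j\<le>N. - ((-1) ^ j * of_nat (N choose j) *
       (1 / of_nat (2 * N + 3 - j) - 1 / of_nat (2 * N + 3 - Suc j))))"
    by (intro sum.cong refl) (simp only: f atMost_iff mult_minus_right)
  also have "\<dots> = - (\<Sum>j\<le>Suc N. (-1) ^ j * of_nat (Suc N choose j) * (1 / of_nat (2 * N + 3 - j)))"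
    by (simp only: alternating_binomial_sum_Suc sum_negf)
  also have "\<dots> = - ((-1) ^ Suc N * fact (Suc N) * fact (2 * N + 3 - Suc (Suc N)) / fact (2 * N + 3))"
    by (subst alternating_sum_choose_reciprocal) simp_all
  also have "2 * N + 3 - Suc (Suc N) = Suc N" by simp
  also have "- ((-1) ^ Suc N * fact (Suc N) * fact (Suc N) / (fact (2 * N + 3) :: complex)) =
      (-1) ^ N * (fact N)\<^sup>2 / (2 * fact ?M) * (of_nat (N + 1) / of_nat (2 * N + 3))"
  proof -
    have "2 * N + 3 = Suc (Suc ?M)" "Suc ?M = 2 * Suc N" by simp_all
    then have "(fact (2 * N + 3) :: complex) = of_nat (2 * N + 3) * (2 * of_nat (Suc N) * fact ?M)"
      by (metis fact_Suc of_nat_mult of_nat_numeral)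
    then show ?thesis
      by (simp only: fact_Suc[of N] of_nat_mult)
        (simp add: power2_eq_square divide_simps del: of_nat_Suc fact_Suc)
  qed
  finally have *: "?S = \<dots>" .
  show ?thesis
    unfolding pade_residual_def fps_sub_nth exp_mult_pade_fps_nth *
    by (simp add: pade_fps_nth power2_eq_square binomial_eq_0 del: fact_Suc of_nat_Suc)
qed

lemma pade_residual_nth_scale: "pade_residual N s $ k = s ^ k * pade_residual N 1 $ k"
  unfolding pade_residual_def fps_sub_nth exp_mult_pade_fps_nth
  by (simp add: pade_fps_nth algebra_simps)

section \<open>The defect of \<open>Xi\<close> as a formal power series\<close>

text \<open>
  To be read with \<open>e = exp z\<close>, \<open>e' = exp (-z)\<close>, capitals for values at \<open>z\<close> and lower case
  for values at \<open>-z\<close>; \<open>A\<close> stands for \<open>F_N\<close> and \<open>B\<close> for \<open>F_N1\<close>, so \<open>r\<close> and \<open>r'\<close> are the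
  residuals of the Pade approximation \<open>B / a\<close> of \<open>exp z\<close> at \<open>z\<close> and \<open>-z\<close>.
\<close>
lemma numerator_defect_identity:
  fixes e e' :: "'a::comm_ring_1"
  assumes "e * e' = 1" "r = e * a - B" "r' = e' * A - b"
  shows "a\<^sup>2 + A\<^sup>2 + b\<^sup>2 + B\<^sup>2 - (e + e') * (a * B + A * b) =
           r\<^sup>2 + r'\<^sup>2 - (e - e') * (r * a - r' * A)"
proof -
  have B: "B = e * a - r" and b: "b = e' * A - r'"
    using assms(2,3) by simp_all
  have "a\<^sup>2 + A\<^sup>2 + b\<^sup>2 + B\<^sup>2 - (e + e') * (a * B + A * b) =
           r\<^sup>2 + r'\<^sup>2 - (e - e') * (r * a - r' * A) + (1 - e * e') * (a\<^sup>2 + A\<^sup>2)"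
    unfolding B b by (simp add: power2_eq_square algebra_simps)
  then show ?thesis
    using assms(1) by simp
qed

definition Xi_denom_fps :: "nat \<Rightarrow> complex fps" where
  "Xi_denom_fps N =
     pade_fps N (2 * N + 1) (-1) * pade_fps (Suc N) (2 * N + 1) 1 +
     pade_fps N (2 * N + 1) 1 * pade_fps (Suc N) (2 * N + 1) (-1)"

definition Xi_numer_fps :: "nat \<Rightarrow> complex fps" where
  "Xi_numer_fps N =
     (pade_fps N (2 * N + 1) (-1))\<^sup>2 + (pade_fps N (2 * N + 1) 1)\<^sup>2 +
     (pade_fps (Suc N) (2 * N + 1) (-1))\<^sup>2 + (pade_fps (Suc N) (2 * N + 1) 1)\<^sup>2"

lemma Xi_denom_fps_nth: "Xi_denom_fps N $ 0 = 2" "Xi_denom_fps N $ 1 = 0"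
  by (simp_all add: Xi_denom_fps_def fps_mult_nth pade_fps_nth del: fact_Suc)

text \<open>The expansion of \<open>Xi\<close>, cleared of its denominator. The sign
  \<open>(-1)^N\<close> is that of \<open>z^(2N+4)\<close> at \<open>z = i\<Omega>\<close>. After
  \<open>X^(2N+2)\<close> is factored out, four coefficients of \<open>K\<close> remain: those of
  index 0, 1 and 3 vanish by parity, and index 2 fixes \<open>D N\<close>.\<close>

lemma Xi_fps_defect:
  assumes "n < 2 * N + 6"
  shows "(Xi_numer_fps N - (fps_exp 1 + fps_exp (-1)) * Xi_denom_fps N -
     fps_const (- 2 * (-1) ^ N * of_real (D N)) * fps_X ^ (2 * N + 4) * Xi_denom_fps N) $ n = 0"
proof -
  define c :: complex where "c = - 2 * (-1) ^ N * of_real (D N)"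
  define p where "p s = pade_fps N (2 * N + 1) s" for s
  define T where "T s = fps_shift (2 * N + 2) (pade_residual N s)" for s
  \<comment> \<open>The squared residuals carry \<open>X^(4N+4)\<close>; removing
    \<open>X^(2N+2)\<close> leaves \<open>X^2 * Y\<close>.\<close>
  define Y :: "complex fps" where "Y = fps_X ^ (2 * N)"
  define O1 where "O1 = T 1 * p (-1) - T (-1) * p 1"
  define Sh :: "complex fps" where "Sh = fps_exp 1 - fps_exp (-1)"
  define S where "S = (T 1)\<^sup>2 + (T (-1))\<^sup>2"
  define K where "K = fps_X\<^sup>2 * (Y * S - fps_const c * Xi_denom_fps N) - Sh * O1"
  have R: "pade_residual N s = fps_X ^ (2 * N + 2) * T s" for s
  proof -
    have "F = fps_X ^ m * fps_shift m F" if "\<And>k. k < m \<Longrightarrow> F $ k = 0" for m and F :: "complex fps"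
      using that by (intro fps_ext) (simp add: fps_X_power_mult_nth)
    note shift = this
    show ?thesis
      unfolding T_def by (rule shift) (rule pade_residual_nth_eq_0)
  qed
  have "Xi_numer_fps N - (fps_exp 1 + fps_exp (-1)) * Xi_denom_fps N =
      (pade_residual N 1)\<^sup>2 + (pade_residual N (-1))\<^sup>2 -
        Sh * (pade_residual N 1 * p (-1) - pade_residual N (-1) * p 1)"
    unfolding Xi_numer_fps_def Xi_denom_fps_def Sh_def p_def
    by (rule numerator_defect_identity)
      (simp_all add: pade_residual_def flip: fps_exp_add_mult)
  then have W: "Xi_numer_fps N - (fps_exp 1 + fps_exp (-1)) * Xi_denom_fps N -
     fps_const c * fps_X ^ (2 * N + 4) * Xi_denom_fps N = fps_X ^ (2 * N + 2) * K"
    unfolding R K_def S_def O1_def Y_def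
    by (simp add: power_add algebra_simps power2_eq_square eval_nat_numeral)
  \<comment> \<open>The shift \<open>2N+2\<close> is even, so \<open>T (-1)\<close> is
    \<open>T 1\<close> reflected. Hence \<open>S\<close> is even and \<open>O1\<close> is
    odd.\<close>
  have T: "T s $ k = s ^ k * T 1 $ k" if "s = 1 \<or> s = -1" for s k
  proof -
    have "s ^ (k + (2 * N + 2)) = s ^ k"
      using that by (auto simp: power_add)
    then show ?thesis
      using pade_residual_nth_scale[of N s "k + (2 * N + 2)"] by (simp only: T_def fps_shift_nth)
  qed
  define t where "t k = T 1 $ k" for k
  have Tt: "T 1 $ k = t k" "T (-1) $ k = (-1) ^ k * t k" for k
    using T[of 1 k] T[of "-1" k] by (auto simp: t_def)
  define q :: complex where "q = (fact N / fact (2 * N + 1))\<^sup>2"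
  have t0: "t 0 = (-1) ^ N * q / 2"
    using pade_residual_nth_0[of N 1] by (simp add: t_def T_def q_def)
  have t1: "t 1 = t 0 * (of_nat (N + 1) / of_nat (2 * N + 3))"
  proof -
    have "t 1 = pade_residual N 1 $ (2 * N + 3)"
      by (simp add: t_def T_def eval_nat_numeral)
    then show ?thesis
      unfolding pade_residual_nth_1 t0 q_def by (simp del: fact_Suc)
  qed
  have pn: "p s $ k = s ^ k * p 1 $ k" for s k
    by (simp add: p_def pade_fps_nth)
  have p0: "p 1 $ 0 = 1"
    by (simp add: p_def pade_fps_nth del: fact_Suc)
  have p1: "p 1 $ 1 = of_nat N / of_nat (2 * N + 1)"
    by (simp add: p_def pade_fps_nth)
  have Sh: "Sh $ 0 = 0" "Sh $ 1 = 2" "Sh $ 2 = 0"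
    by (simp_all add: Sh_def)
  have O_even: "O1 $ 0 = 0" "O1 $ 2 = 0"
    by (simp_all add: O1_def fps_mult_nth Tt pn[of "-1"] numeral_2_eq_2)
  have O_1: "O1 $ 1 = 2 * (t 1 - of_nat N / of_nat (2 * N + 1) * t 0)"
    using p0 p1 by (simp add: O1_def fps_mult_nth Tt pn[of "-1"] algebra_simps del: of_nat_Suc)
  have "(of_nat (2 * N + 1) :: complex) \<noteq> 0" "(of_nat (2 * N + 3) :: complex) \<noteq> 0"
    by (simp_all only: of_nat_eq_0_iff)
  \<comment> \<open>Since \<open>(N+1)(2N+1) - N(2N+3) = 1\<close>. This is the origin of the
    factors \<open>2N+1\<close> and \<open>2N+3\<close> in \<open>D N\<close>.\<close>
  then have "t 1 - of_nat N / of_nat (2 * N + 1) * t 0 =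
      t 0 / (of_nat (2 * N + 1) * of_nat (2 * N + 3))"
    unfolding t1 by (simp add: divide_simps) (simp add: algebra_simps)
  then have O_1': "O1 $ 1 = (-1) ^ N * q / (of_nat (2 * N + 1) * of_nat (2 * N + 3))"
    unfolding O_1 t0 by simp
  have S01: "S $ 0 = 2 * (t 0)\<^sup>2" "S $ 1 = 0"
    by (simp_all add: S_def power2_eq_square fps_mult_nth Tt)
  \<comment> \<open>For \<open>N = 0\<close> this reads \<open>1/2 = -1/6 + 2/3\<close>; for
    \<open>N \<ge> 1\<close> both sides are 0.\<close>
  have YS: "(Y * S) $ 0 = 2 * c + 2 * O1 $ 1"
  proof (cases "N = 0")
    case True
    then show ?thesis
      unfolding O_1' by (simp add: Y_def S01 t0 q_def c_def D_def power2_eq_square)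
  next
    case False
    moreover have "complex_of_real (D N) = q / (2 * (of_nat (2 * N + 1) * of_nat (2 * N + 3)))"
      using False by (simp add: D_def q_def del: fact_Suc)
    ultimately show ?thesis
      unfolding O_1' c_def by (simp add: Y_def)
  qed
  have YS1: "(Y * S) $ 1 = 0"
    using S01 by (cases N) (simp_all add: Y_def fps_X_power_mult_nth del: power_Suc)
  have K_nth: "K $ k = (if k < 2 then 0 else (Y * S) $ (k - 2) - c * Xi_denom_fps N $ (k - 2)) -
      (\<Sum>i=0..k. Sh $ i * O1 $ (k - i))" for k
    by (simp add: K_def fps_X_power_mult_nth fps_mult_nth[of Sh])
  have K: "K $ k = 0" if "k < 4" for k
  proof -
    have "k = 0 \<or> k = 1 \<or> k = 2 \<or> k = 3" using that by auto
    moreover have "K $ 0 = 0" "K $ 1 = 0"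
      using Sh O_even by (simp_all add: K_nth)
    moreover have "K $ 2 = 0"
      using Sh O_even YS Xi_denom_fps_nth[of N] by (simp add: K_nth numeral_2_eq_2)
    moreover have "K $ 3 = 0"
      using Sh O_even YS1 Xi_denom_fps_nth[of N] by (simp add: K_nth eval_nat_numeral)
    ultimately show ?thesis by metis
  qed
  show ?thesis
    unfolding W[unfolded c_def] using assms K by (simp only: fps_X_power_mult_nth) simp
qed

section \<open>From power series to asymptotics at 0\<close>

text \<open>Dividing by \<open>z^n\<close> shifts the series, and the quotient extends continuously
  to 0, hence is bounded nearby. The zero series is separate because its \<open>subdegree\<close> is
  0 by convention.\<close>

lemma has_fps_expansion_imp_bigo:
  fixes f :: "'a :: {banach, real_normed_field} \<Rightarrow> 'a"
  assumes f: "f has_fps_expansion F" and zero: "\<And>k. k < n \<Longrightarrow> F $ k = 0"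
  shows "f \<in> O[at 0](\<lambda>z. z ^ n)"
proof (cases "F = 0")
  case True
  with f have "eventually (\<lambda>z. f z = 0) (nhds 0)"
    by (auto simp: has_fps_expansion_def elim: eventually_mono)
  then have "eventually (\<lambda>z. f z = 0) (at 0)"
    using eventually_nhds_conv_at by blast
  then show ?thesis
    by (subst landau_o.big.in_cong[where g = "\<lambda>_. 0"]) auto
next
  case False
  then have "n \<le> subdegree F"
    using zero by (intro subdegree_geI) auto
  from has_fps_expansion_imp_continuous[OF has_fps_expansion_shift[OF f this refl]]
  have "((\<lambda>x. if x = 0 then F $ n else f x / x ^ n) \<longlongrightarrow> F $ n) (at 0)"
    by (simp add: continuous_within)
  then have "((\<lambda>x. f x / x ^ n) \<longlongrightarrow> F $ n) (at 0)"
    by (rule Lim_transform_eventually) (auto simp: eventually_at_filter)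
  then show ?thesis
    by (rule bigoI_tendsto) (rule eventually_mono[OF eventually_neq_at_within[of 0]], simp)
qed

text \<open>The series estimate is restricted to the imaginary axis \<open>z = i\<Omega>\<close>,
  where \<open>exp z + exp (-z)\<close> is \<open>2 cos \<Omega>\<close>, and divided by the
  denominator, which tends to 2.\<close>

lemma Xi_defect_bigo:
  "(\<lambda>\<Omega>. Xi N \<Omega> - 2 * of_real (cos \<Omega>) + 2 * of_real (D N) * of_real \<Omega> ^ (2 * N + 4))
     \<in> O[at 0](\<lambda>\<Omega>. of_real \<Omega> ^ (2 * N + 6))"
proof -
  have params: "- 2 * of_nat N - 1 = - complex_of_nat (2 * N + 1)"
       "- of_nat N - 1 = - complex_of_nat (Suc N)"
    by simp_all
  have F: "F_N N = hyp1F1 (- of_nat N) (- of_nat (2 * N + 1))"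
    unfolding F_N_def params ..
  have F1: "F_N1 N = hyp1F1 (- of_nat (Suc N)) (- of_nat (2 * N + 1))"
    unfolding F_N1_def params ..
  have exF: "(\<lambda>z. F_N N z) has_fps_expansion pade_fps N (2 * N + 1) 1"
       "(\<lambda>z. F_N N (-z)) has_fps_expansion pade_fps N (2 * N + 1) (-1)"
    using hyp1F1_has_fps_expansion[of N "2 * N + 1" 1]
          hyp1F1_has_fps_expansion[of N "2 * N + 1" "-1"]
    by (simp_all add: F del: of_nat_add of_nat_Suc)
  have exF1: "(\<lambda>z. F_N1 N z) has_fps_expansion pade_fps (Suc N) (2 * N + 1) 1"
       "(\<lambda>z. F_N1 N (-z)) has_fps_expansion pade_fps (Suc N) (2 * N + 1) (-1)"
    using hyp1F1_has_fps_expansion[of "Suc N" "2 * N + 1" 1]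
          hyp1F1_has_fps_expansion[of "Suc N" "2 * N + 1" "-1"]
    by (simp_all add: F1 del: of_nat_add of_nat_Suc)
  define num where "num z = (F_N N (-z))\<^sup>2 + (F_N N z)\<^sup>2 + (F_N1 N (-z))\<^sup>2 + (F_N1 N z)\<^sup>2" for z
  define den where "den z = F_N N (-z) * F_N1 N z + F_N N z * F_N1 N (-z)" for z
  define c :: complex where "c = - 2 * (-1) ^ N * of_real (D N)"
  define W where "W z = num z - (exp z + exp (-z)) * den z - c * z ^ (2 * N + 4) * den z" for z
  have ex_num: "num has_fps_expansion Xi_numer_fps N"
    unfolding num_def Xi_numer_fps_def power2_eq_square
    by (intro fps_expansion_intros exF exF1)
  have ex_den: "den has_fps_expansion Xi_denom_fps N"
    unfolding den_def Xi_denom_fps_def by (intro fps_expansion_intros exF exF1)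
  have "W has_fps_expansion (Xi_numer_fps N - (fps_exp 1 + fps_exp (-1)) * Xi_denom_fps N -
     fps_const c * fps_X ^ (2 * N + 4) * Xi_denom_fps N)"
    unfolding W_def by (intro fps_expansion_intros ex_num ex_den)
  then have W: "W \<in> O[at 0](\<lambda>z. z ^ (2 * N + 6))"
    by (rule has_fps_expansion_imp_bigo) (unfold c_def, rule Xi_fps_defect)
  have lim: "filterlim (\<lambda>\<Omega>. \<i> * complex_of_real \<Omega>) (at 0) (at 0)"
    by (rule filterlim_atI) (auto intro!: tendsto_eq_intros simp: eventually_at_filter)
  have "(\<lambda>\<Omega>. W (\<i> * of_real \<Omega>)) \<in> O[at 0](\<lambda>\<Omega>. (\<i> * of_real \<Omega>) ^ (2 * N + 6))"
    by (rule landau_o.big.compose[OF W lim])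
  then have W': "(\<lambda>\<Omega>. W (\<i> * of_real \<Omega>)) \<in> O[at 0](\<lambda>\<Omega>. of_real \<Omega> ^ (2 * N + 6))"
    by (simp add: power_mult_distrib del: power_Suc)
  have "(den \<longlongrightarrow> 2) (at 0)"
    using has_fps_expansion_imp_continuous[OF ex_den, of UNIV] fps_nth_fps_expansion[OF ex_den, of 0]
    by (simp add: continuous_within Xi_denom_fps_nth)
  then have den_lim: "((\<lambda>\<Omega>. den (\<i> * of_real \<Omega>)) \<longlongrightarrow> 2) (at (0::real))"
    by (rule filterlim_compose[OF _ lim])
  then have den_nz: "eventually (\<lambda>\<Omega>. den (\<i> * of_real \<Omega>) \<noteq> 0) (at (0::real))"
    by (rule tendsto_imp_eventually_ne) simp
  have "((\<lambda>\<Omega>. inverse (den (\<i> * of_real \<Omega>))) \<longlongrightarrow> inverse 2) (at (0::real))"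
    by (intro tendsto_inverse den_lim) simp
  then have "(\<lambda>\<Omega>. inverse (den (\<i> * of_real \<Omega>))) \<in> O[at (0::real)](\<lambda>_. 1)"
    by (intro bigoI_tendsto) simp_all
  from landau_o.big.mult[OF W' this]
  have "(\<lambda>\<Omega>. W (\<i> * of_real \<Omega>) * inverse (den (\<i> * of_real \<Omega>)))
      \<in> O[at 0](\<lambda>\<Omega>. of_real \<Omega> ^ (2 * N + 6))"
    by simp
  moreover have "eventually (\<lambda>\<Omega>. W (\<i> * of_real \<Omega>) * inverse (den (\<i> * of_real \<Omega>)) =
      Xi N \<Omega> - 2 * of_real (cos \<Omega>) + 2 * of_real (D N) * of_real \<Omega> ^ (2 * N + 4)) (at 0)"
    using den_nz
  proof eventually_elim
    case (elim \<Omega>)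
    have "Xi N \<Omega> = num (\<i> * of_real \<Omega>) / den (\<i> * of_real \<Omega>)"
      by (simp add: Xi_def Let_def num_def den_def)
    moreover have "exp (\<i> * of_real \<Omega>) + exp (- (\<i> * of_real \<Omega>)) = 2 * complex_of_real (cos \<Omega>)"
      using cos_exp_eq[of "of_real \<Omega>"] by (simp add: cos_of_real mult.commute[of _ 2])
    moreover have "c * (\<i> * of_real \<Omega>) ^ (2 * N + 4) = - 2 * of_real (D N) * of_real \<Omega> ^ (2 * N + 4)"
      by (simp add: c_def power_mult_distrib power_add power_mult power_minus[of "(of_real \<Omega>)\<^sup>2"])
    moreover have "(n - e * d + x * d) * inverse d = n / d - e + x" if "d \<noteq> 0" for n e x d :: complex
      using that by (simp add: divide_simps)
    ultimately show ?case
      using elim by (simp only: W_def) simp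
  qed
  ultimately show ?thesis
    by (simp only: landau_o.big.in_cong)
qed

section \<open>Root selection and the quadratic equation for the relative error\<close>

lemma Im_csqrt_of_Reals_nonneg: "x \<in> \<real> \<Longrightarrow> Im (csqrt x) \<ge> 0"
  by (auto simp: complex_is_Real_iff intro: abs_Re_le_cmod abs_le_D1)

text \<open>In \<open>sin \<Omega> - Im \<lambda>\<close>, with \<lambda> the minus root, the two
  terms never cancel, whatever the sign of \<open>Xi^2 - 4\<close>.\<close>

lemma sin_le_norm_diff_lambda_minus: "\<bar>sin \<Omega>\<bar> \<le> norm (exp (\<i> * of_real \<Omega>) - lambda_minus N \<Omega>)"
proof -
  have r: "Im (Xi N \<Omega>) = 0" "Im (csqrt ((Xi N \<Omega>)\<^sup>2 - 4)) \<ge> 0"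
    using Xi_real by (auto simp: complex_is_Real_iff[symmetric] intro!: Im_csqrt_of_Reals_nonneg
        simp del: csqrt.sel)
  have "\<bar>sin \<Omega>\<bar> \<le> \<bar>Im (exp (\<i> * of_real \<Omega>) - lambda_minus N \<Omega>)\<bar>"
    using r by (simp add: lambda_minus_def Im_exp del: csqrt.sel)
  also have "\<dots> \<le> norm (exp (\<i> * of_real \<Omega>) - lambda_minus N \<Omega>)"
    by (rule abs_Im_le_cmod)
  finally show ?thesis .
qed

text \<open>The first identity evaluates the characteristic polynomial at
  \<open>u = exp(i\<Omega>)\<close>, using \<open>u^2 + 1 = 2 u cos \<Omega>\<close>; the second
  uses that the two roots sum to \<open>Xi\<close>.\<close>

lemma rho_plus_identities:
  defines "\<epsilon> \<equiv> \<lambda>N \<Omega>. Xi N \<Omega> - 2 * of_real (cos \<Omega>)"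
  shows "rho_plus N \<Omega> * (exp (\<i> * of_real \<Omega>) - lambda_minus N \<Omega>) = - \<epsilon> N \<Omega>"
    and "exp (\<i> * of_real \<Omega>) - lambda_minus N \<Omega> =
           2 * \<i> * of_real (sin \<Omega>) - \<epsilon> N \<Omega> - exp (\<i> * of_real \<Omega>) * rho_plus N \<Omega>"
proof -
  define u where "u = exp (\<i> * of_real \<Omega>)"
  have u0: "u \<noteq> 0" by (simp add: u_def)
  have u: "u = of_real (cos \<Omega>) + \<i> * of_real (sin \<Omega>)"
    by (simp add: u_def exp_Euler cos_of_real sin_of_real)
  have "(complex_of_real (sin \<Omega>))\<^sup>2 = 1 - (of_real (cos \<Omega>))\<^sup>2"
    by (simp add: sin_squared_eq flip: of_real_power)
  then have "u\<^sup>2 + 1 = 2 * of_real (cos \<Omega>) * u"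
    unfolding u by (simp add: power2_eq_square algebra_simps)
  then have "(u - lambda_plus N \<Omega>) * (u - lambda_minus N \<Omega>) = - (u * \<epsilon> N \<Omega>)"
    unfolding \<epsilon>_def using lambda_roots[of u N \<Omega>] by (simp add: algebra_simps)
  then show "rho_plus N \<Omega> * (exp (\<i> * of_real \<Omega>) - lambda_minus N \<Omega>) = - \<epsilon> N \<Omega>"
    using u0 unfolding rho_plus_def u_def[symmetric] by (simp add: divide_simps mult.commute)
  have "lambda_minus N \<Omega> = Xi N \<Omega> - lambda_plus N \<Omega>"
    by (simp add: lambda_plus_def lambda_minus_def field_simps)
  moreover have "u * rho_plus N \<Omega> = u - lambda_plus N \<Omega>"
    using u0 by (simp add: rho_plus_def u_def)
  ultimately show "exp (\<i> * of_real \<Omega>) - lambda_minus N \<Omega> =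
           2 * \<i> * of_real (sin \<Omega>) - \<epsilon> N \<Omega> - exp (\<i> * of_real \<Omega>) * rho_plus N \<Omega>"
    unfolding u_def[symmetric] \<epsilon>_def by (simp add: u)
qed

section \<open>Bootstrapping from a crude bound to the leading term\<close>

lemma bigo_power_at_0_mono:
  "n \<le> m \<Longrightarrow> (\<lambda>x::real. complex_of_real x ^ m) \<in> O[at 0](\<lambda>x. of_real x ^ n)"
proof (rule bigoI[where c = 1])
  assume "n \<le> m"
  have "eventually (\<lambda>x::real. \<bar>x\<bar> < 1) (at 0)"
    by (auto simp: eventually_at intro: exI[of _ 1])
  then show "eventually (\<lambda>x. norm (complex_of_real x ^ m) \<le> 1 * norm (complex_of_real x ^ n)) (at 0)"
    by eventually_elim (use \<open>n \<le> m\<close> in \<open>auto simp: norm_power intro!: power_decreasing\<close>)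
qed

theorem mainTheorem3:
  fixes N :: nat
  shows "(\<lambda>\<Omega>::real. rho_plus N \<Omega> - (- \<i> * of_real (D N) * of_real \<Omega> ^ (2 * N + 3)))
           \<in> O[at 0](\<lambda>\<Omega>. of_real \<Omega> ^ (2 * N + 5))"
proof -
  define P where "P k = (\<lambda>\<Omega>::real. complex_of_real \<Omega> ^ k)" for k
  define \<epsilon> where "\<epsilon> = (\<lambda>\<Omega>. Xi N \<Omega> - 2 * of_real (cos \<Omega>))"
  define \<rho> where "\<rho> = rho_plus N"
  have P_mult: "P m \<Omega> * P n \<Omega> = P (m + n) \<Omega>" for m n \<Omega>
    by (simp add: P_def power_add)
  have P_mono: "f \<in> O[at 0](P n)" if "f \<in> O[at 0](P m)" "n \<le> m" for f m n
    using landau_o.big_trans[OF that(1)] bigo_power_at_0_mono[OF that(2)] by (simp add: P_def)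
  have P_nz: "eventually (\<lambda>\<Omega>. P k \<Omega> \<noteq> 0) (at 0)" for k
    unfolding P_def by (rule eventually_mono[OF eventually_neq_at_within[of 0]]) simp
  have \<epsilon>_asymp: "(\<lambda>\<Omega>. \<epsilon> \<Omega> + 2 * of_real (D N) * P (2 * N + 4) \<Omega>) \<in> O[at 0](P (2 * N + 6))"
    using Xi_defect_bigo[of N] by (simp add: \<epsilon>_def P_def del: power_Suc)
  have "(\<lambda>\<Omega>. (\<epsilon> \<Omega> + 2 * of_real (D N) * P (2 * N + 4) \<Omega>) - 2 * of_real (D N) * P (2 * N + 4) \<Omega>)
      \<in> O[at 0](P (2 * N + 4))"
    by (rule sum_in_bigo) (rule P_mono[OF \<epsilon>_asymp], simp, simp)
  then have \<epsilon>_bigo: "\<epsilon> \<in> O[at 0](P (2 * N + 4))" by simp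

  \<comment> \<open>An a priori bound on \<rho>, needed before the quadratic term in \<rho> can be
    treated as an error.\<close>
  have "eventually (\<lambda>\<Omega>::real. norm (\<rho> \<Omega> * of_real (sin \<Omega>)) \<le> 1 * norm (\<epsilon> \<Omega>)) (at 0)"
  proof (intro always_eventually allI)
    fix \<Omega> :: real
    have "norm (\<rho> \<Omega> * of_real (sin \<Omega>)) \<le> norm (\<rho> \<Omega>) * norm (exp (\<i> * of_real \<Omega>) - lambda_minus N \<Omega>)"
      using sin_le_norm_diff_lambda_minus by (simp add: norm_mult mult_left_mono)
    also have "\<dots> = norm (- \<epsilon> \<Omega>)"
      unfolding \<epsilon>_def \<rho>_def rho_plus_identities(1)[symmetric] by (simp add: norm_mult)
    finally show "norm (\<rho> \<Omega> * of_real (sin \<Omega>)) \<le> 1 * norm (\<epsilon> \<Omega>)" by simp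
  qed
  from landau_o.big_trans[OF bigoI[OF this] \<epsilon>_bigo]
  have \<rho>_sin: "(\<lambda>\<Omega>. \<rho> \<Omega> * of_real (sin \<Omega>)) \<in> O[at 0](P (2 * N + 4))" .

  have sin_lim: "((\<lambda>\<Omega>::real. sin \<Omega> / \<Omega>) \<longlongrightarrow> 1) (at 0)"
    using DERIV_sin[of 0] by (simp add: has_field_derivative_iff)
  from sin_lim have sin_nz: "eventually (\<lambda>\<Omega>::real. sin \<Omega> \<noteq> 0) (at 0)"
    by (rule eventually_mono[OF tendsto_imp_eventually_ne[of _ _ _ 0]]) auto
  have P1_bigo: "P 1 \<in> O[at 0](\<lambda>\<Omega>. of_real (sin \<Omega>))"
  proof -
    from tendsto_inverse[OF sin_lim] have "((\<lambda>\<Omega>::real. \<Omega> / sin \<Omega>) \<longlongrightarrow> 1) (at 0)"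
      by simp
    then have "((\<lambda>\<Omega>::real. complex_of_real (\<Omega> / sin \<Omega>)) \<longlongrightarrow> of_real 1) (at 0)"
      by (rule tendsto_of_real)
    then show ?thesis
      using sin_nz by (intro bigoI_tendsto) (simp_all add: P_def)
  qed
  \<comment> \<open>Division by the sine: multiplying by \<open>\<Omega> = O(sin \<Omega>)\<close>
    creates the common factor \<open>\<Omega> * sin \<Omega>\<close>, which is then
    cancelled.\<close>
  have "(\<lambda>\<Omega>. \<rho> \<Omega> * of_real (sin \<Omega>) * P 1 \<Omega>) \<in>
      O[at 0](\<lambda>\<Omega>. P (2 * N + 3) \<Omega> * (of_real (sin \<Omega>) * P 1 \<Omega>))"
    using landau_o.big.mult[OF \<rho>_sin P1_bigo]
    by (simp add: P_def power_add eval_nat_numeral mult_ac)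
  then have \<rho>_bigo: "\<rho> \<in> O[at 0](P (2 * N + 3))"
    using eventually_conj[OF sin_nz P_nz[of 1]]
    by (subst (asm) mult.assoc, subst (asm) landau_o.big.mult_cancel_right) (auto elim: eventually_mono)

  have "(\<lambda>x::real. x - sin x) \<in> O[at 0](\<lambda>x. x ^ 3)"
  proof (rule has_fps_expansion_imp_bigo)
    show "(\<lambda>x::real. x - sin x) has_fps_expansion (fps_X - fps_sin 1)"
      by (intro fps_expansion_intros)
    show "(fps_X - fps_sin 1) $ k = (0::real)" if "k < 3" for k
    proof -
      have "k = 0 \<or> k = 1 \<or> k = 2" using that by auto
      then show ?thesis by (auto simp: fps_sin_def)
    qed
  qed
  then have "(\<lambda>\<Omega>. complex_of_real (\<Omega> - sin \<Omega>)) \<in> O[at 0](\<lambda>\<Omega>. of_real (\<Omega> ^ 3))"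
    by (simp only: landau_o.big.of_real_iff)
  then have sin_bigo: "(\<lambda>\<Omega>. complex_of_real (\<Omega> - sin \<Omega>)) \<in> O[at 0](P 3)"
    by (simp add: P_def)

  have exp_bigo: "(\<lambda>\<Omega>::real. exp (\<i> * of_real \<Omega>)) \<in> O[at 0](P 0)"
    by (rule bigoI[where c = 1]) (simp add: P_def)
  \<comment> \<open>The orders that arise are \<open>2N+6\<close> for
    \<open>(\<Omega> - sin \<Omega>) \<rho>\<close>, \<open>4N+7\<close> for
    \<open>\<epsilon> \<rho>\<close> and \<open>4N+6\<close> for \<open>u \<rho>^2\<close>; the last
    is just enough when \<open>N = 0\<close>.\<close>
  have mult: "(\<lambda>\<Omega>. f \<Omega> * g \<Omega>) \<in> O[at 0](P (2 * N + 6))"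
    if "f \<in> O[at 0](P m)" "g \<in> O[at 0](P n)" "2 * N + 6 \<le> m + n" for f g m n
    by (rule P_mono[OF _ that(3)]) (use landau_o.big.mult[OF that(1,2)] in \<open>simp add: P_mult\<close>)
  have u_\<rho>_bigo: "(\<lambda>\<Omega>. exp (\<i> * of_real \<Omega>) * \<rho> \<Omega>) \<in> O[at 0](P (2 * N + 3))"
    using landau_o.big.mult[OF exp_bigo \<rho>_bigo] by (simp add: P_mult)
  \<comment> \<open>Dividing by \<open>2i sin \<Omega>\<close> is traded for a division by \<open>2i\<Omega>\<close>, at the cost of
    the term \<open>(\<Omega> - sin \<Omega>) \<rho> = O(\<Omega>^(2N+6))\<close>.\<close>
  have "(\<lambda>\<Omega>. 2 * \<i> * (complex_of_real (\<Omega> - sin \<Omega>) * \<rho> \<Omega>)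
        - (\<epsilon> \<Omega> + 2 * of_real (D N) * P (2 * N + 4) \<Omega>)
        + \<epsilon> \<Omega> * \<rho> \<Omega> + exp (\<i> * of_real \<Omega>) * \<rho> \<Omega> * \<rho> \<Omega>) \<in> O[at 0](P (2 * N + 6))"
    by (intro sum_in_bigo(1) sum_in_bigo(2) \<epsilon>_asymp mult[OF \<epsilon>_bigo \<rho>_bigo] mult[OF u_\<rho>_bigo \<rho>_bigo])
      (use mult[OF sin_bigo \<rho>_bigo] in simp_all)
  also have "(\<lambda>\<Omega>. 2 * \<i> * (complex_of_real (\<Omega> - sin \<Omega>) * \<rho> \<Omega>)
        - (\<epsilon> \<Omega> + 2 * of_real (D N) * P (2 * N + 4) \<Omega>)
        + \<epsilon> \<Omega> * \<rho> \<Omega> + exp (\<i> * of_real \<Omega>) * \<rho> \<Omega> * \<rho> \<Omega>) =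
      (\<lambda>\<Omega>. 2 * \<i> * (P 1 \<Omega> * (\<rho> \<Omega> - (- \<i> * of_real (D N) * P (2 * N + 3) \<Omega>))))"
  proof
    fix \<Omega>
    have *: "\<rho> \<Omega> * (2 * \<i> * of_real (sin \<Omega>) - \<epsilon> \<Omega> - exp (\<i> * of_real \<Omega>) * \<rho> \<Omega>) = - \<epsilon> \<Omega>"
      using rho_plus_identities(1)[of N \<Omega>, unfolded rho_plus_identities(2)[of \<Omega> N]]
      by (simp add: \<epsilon>_def \<rho>_def)
    have p: "P (2 * N + 4) \<Omega> = P 1 \<Omega> * P (2 * N + 3) \<Omega>"
      by (simp add: P_mult eval_nat_numeral)
    have "P 1 \<Omega> = of_real \<Omega>" by (simp add: P_def)
    then show "2 * \<i> * (complex_of_real (\<Omega> - sin \<Omega>) * \<rho> \<Omega>)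
        - (\<epsilon> \<Omega> + 2 * of_real (D N) * P (2 * N + 4) \<Omega>)
        + \<epsilon> \<Omega> * \<rho> \<Omega> + exp (\<i> * of_real \<Omega>) * \<rho> \<Omega> * \<rho> \<Omega> =
      2 * \<i> * (P 1 \<Omega> * (\<rho> \<Omega> - (- \<i> * of_real (D N) * P (2 * N + 3) \<Omega>)))"
      using * unfolding p by (simp add: algebra_simps)
  qed
  finally have "(\<lambda>\<Omega>. P 1 \<Omega> * (\<rho> \<Omega> - (- \<i> * of_real (D N) * P (2 * N + 3) \<Omega>)))
      \<in> O[at 0](P (2 * N + 6))"
    by simp
  also have "P (2 * N + 6) = (\<lambda>\<Omega>. P 1 \<Omega> * P (2 * N + 5) \<Omega>)"
    by (simp add: P_mult eval_nat_numeral)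
  finally have "(\<lambda>\<Omega>. \<rho> \<Omega> - (- \<i> * of_real (D N) * P (2 * N + 3) \<Omega>)) \<in> O[at 0](P (2 * N + 5))"
    by (subst (asm) landau_o.big.mult_cancel_left[OF bigtheta_refl P_nz])
  then show ?thesis
    by (simp only: \<rho>_def P_def)
qed

end
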